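(* Let $\mathcal{K}:\mathbb{R}\to\mathbb{R}$ be a square summable (i.e. $\int \mathcal{K}^2<\infty$) kernel function whose Fourier transform is different from zero almost everywhere, let $h>0$, and let $\mathcal{K}_2$ be the convolution of $\mathcal{K}$ with its mirror, i.e. $\mathcal{K}_2(u)=\int\mathcal{K}(u+v)\mathcal{K}(v)\,dv$. For real random variables $Y_1,\ldots,Y_K$ (with finite variance), $$Q(Y_1,\ldots,Y_K)=\frac12\left\{E\left[\pi_{\mathbf{Y}}(\mathbf{Y})\right]+\prod_{k=1}^{K}E\left[\pi_{Y_k}(Y_k)\right]-2E\left[\prod_{k=1}^{K}\pi_{Y_k}(Y_k)\right]\right\},$$ where $\mathbf{Y}=(Y_1,\ldots,Y_K)^T$ and, for deterministic $\mathbf{y}=(y_1,\ldots,y_K)\in\mathbb{R}^K$, $$\pi_{\mathbf{Y}}(\mathbf{y})=E\left[\prod_{i=1}^{K}\mathcal{K}_{2,h}\left(\frac{y_i-Y_i}{\sigma_{Y_i}}\right)\right],\qquad \pi_{Y_k}(y_k)=E\left[\mathcal{K}_{2,h}\left(\frac{y_k-Y_k}{\sigma_{Y_k}}\right)\right].$$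
   Context: Set $\mathcal{K}_h(x)=\mathcal{K}(x/h)/h$ and $\mathcal{K}_{2,h}(x)=\mathcal{K}_2(x/h)/h$. For each $k$, $\sigma_{Y_k}>0$ is a scale factor, i.e. the value at $Y_k$ of a functional $\sigma$ of the distribution, positive at $Y_k$, satisfying $\sigma_{\lambda Y_k}=|\lambda|\sigma_{Y_k}$ for every nonzero real constant $\lambda$. Define $$D_{\mathbf{Y}}(y_1,\ldots,y_K)=E\left[\prod_{k=1}^{K}\mathcal{K}_h\left(y_k-\frac{Y_k}{\sigma_{Y_k}}\right)\right]-\prod_{k=1}^{K}E\left[\mathcal{K}_h\left(y_k-\frac{Y_k}{\sigma_{Y_k}}\right)\right].$$ The quadratic dependence of $Y_1,\ldots,Y_K$ is $$Q(Y_1,\ldots,Y_K)=\frac12\int_{\mathbb{R}^K} D_{\mathbf{Y}}(y_1,\ldots,y_K)^2\,dy_1\cdots dy_K .$$ In the formula of the claim, $\pi_{\mathbf{Y}}$ and $\pi_{Y_k}$ are deterministic functions, which are then evaluated at the random arguments $\mathbf{Y}$ and $Y_k$. *)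

theory Defs
  imports "HOL-Probability.Probability"
begin

definition scaled_kernel :: "(real \<Rightarrow> real) \<Rightarrow> real \<Rightarrow> real \<Rightarrow> real" where
  "scaled_kernel \<kappa> h x = \<kappa> (x / h) / h"

definition mirror_convolution :: "(real \<Rightarrow> real) \<Rightarrow> real \<Rightarrow> real" where
  "mirror_convolution \<kappa> u = (\<integral>v. \<kappa> (u + v) * \<kappa> v \<partial>lborel)"

(* A square integrable kernel need not be integrable, so its Fourier transform is the
   Fourier-Plancherel transform: the L2 limit of the transforms of the truncations to [-R, R].
   It is determined only up to a null set and is therefore a relation here. The L2 distance is
   a nonnegative integral, so that convergence to 0 cannot hold by a non-integrable
   Bochner integral being 0. *)
definition fourier_plancherel :: "(real \<Rightarrow> real) \<Rightarrow> (real \<Rightarrow> complex) \<Rightarrow> bool" where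
  "fourier_plancherel f F \<longleftrightarrow>
     F \<in> borel_measurable lborel \<and>
     integrable lborel (\<lambda>t. (cmod (F t))\<^sup>2) \<and>
     ((\<lambda>R::real. \<integral>\<^sup>+t. ennreal ((cmod (F t -
          (LINT x:{-R..R}|lborel. exp (- (\<i> * of_real (t * x))) * of_real (f x))))\<^sup>2) \<partial>lborel)
        \<longlongrightarrow> 0) at_top"

(* A functional of the distribution, evaluated at the law of X. *)
definition scale_of :: "(real measure \<Rightarrow> real) \<Rightarrow> 'a measure \<Rightarrow> ('a \<Rightarrow> real) \<Rightarrow> real" where
  "scale_of \<sigma> M X = \<sigma> (distr M borel X)"

definition scale_factor :: "(real measure \<Rightarrow> real) \<Rightarrow> 'a measure \<Rightarrow> ('a \<Rightarrow> real) \<Rightarrow> bool" where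
  "scale_factor \<sigma> M X \<longleftrightarrow>
     scale_of \<sigma> M X > 0 \<and>
     (\<forall>c. c \<noteq> 0 \<longrightarrow> scale_of \<sigma> M (\<lambda>\<omega>. c * X \<omega>) = \<bar>c\<bar> * scale_of \<sigma> M X)"

(* For a square integrable kernel the expectations below exist for almost every y only;
   on the exceptional null set they take the default value of the Bochner integral,
   which does not affect the quadratic dependence. *)
definition dependence_D ::
  "(real \<Rightarrow> real) \<Rightarrow> real \<Rightarrow> (real measure \<Rightarrow> real) \<Rightarrow> 'a measure \<Rightarrow>
     ('n::finite \<Rightarrow> 'a \<Rightarrow> real) \<Rightarrow> real ^ 'n \<Rightarrow> real" where
  "dependence_D \<kappa> h \<sigma> M Y y =
     (\<integral>\<omega>. (\<Prod>k\<in>UNIV. scaled_kernel \<kappa> h (y $ k - Y k \<omega> / scale_of \<sigma> M (Y k))) \<partial>M)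
     - (\<Prod>k\<in>UNIV. \<integral>\<omega>. scaled_kernel \<kappa> h (y $ k - Y k \<omega> / scale_of \<sigma> M (Y k)) \<partial>M)"

definition quadratic_dependence ::
  "(real \<Rightarrow> real) \<Rightarrow> real \<Rightarrow> (real measure \<Rightarrow> real) \<Rightarrow> 'a measure \<Rightarrow>
     ('n::finite \<Rightarrow> 'a \<Rightarrow> real) \<Rightarrow> real" where
  "quadratic_dependence \<kappa> h \<sigma> M Y =
     1 / 2 * (\<integral>y. (dependence_D \<kappa> h \<sigma> M Y y)\<^sup>2 \<partial>lborel)"

definition joint_pi ::
  "(real \<Rightarrow> real) \<Rightarrow> real \<Rightarrow> (real measure \<Rightarrow> real) \<Rightarrow> 'a measure \<Rightarrow>
     ('n::finite \<Rightarrow> 'a \<Rightarrow> real) \<Rightarrow> real ^ 'n \<Rightarrow> real" where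
  "joint_pi \<kappa> h \<sigma> M Y y =
     (\<integral>\<omega>. (\<Prod>i\<in>UNIV. scaled_kernel (mirror_convolution \<kappa>) h
        ((y $ i - Y i \<omega>) / scale_of \<sigma> M (Y i))) \<partial>M)"

definition marginal_pi ::
  "(real \<Rightarrow> real) \<Rightarrow> real \<Rightarrow> (real measure \<Rightarrow> real) \<Rightarrow> 'a measure \<Rightarrow>
     ('a \<Rightarrow> real) \<Rightarrow> real \<Rightarrow> real" where
  "marginal_pi \<kappa> h \<sigma> M X x =
     (\<integral>\<omega>. scaled_kernel (mirror_convolution \<kappa>) h ((x - X \<omega>) / scale_of \<sigma> M X) \<partial>M)"

end

(* Write D = U - V, where U is the expectation of A(y, w) = prod_k g(y_k - Z_k(w)) and
   V(y) = prod_k u_k(y_k) with u_k(x) = E g(x - Z_k). Since the L2 norm of A(., w) does not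
   depend on w, Fubini's theorem gives <U, v> = E <A(., w), v> for every v in L2. Taking v
   to be A(., w'), U and V in turn, and the analogous one-dimensional identity for u_k,
   reduces the three terms of ||U - V||^2 to the inner products of translates of g, which
   are the values of the mirror convolution. *)
theory Submission
  imports Defs
begin

lemma abs_mult_le_sum_squares: "\<bar>a * b\<bar> \<le> a\<^sup>2 + b\<^sup>2" for a b :: real
proof -
  have "2 * \<bar>a * b\<bar> \<le> a\<^sup>2 + b\<^sup>2"
    using sum_squares_bound[of "\<bar>a\<bar>" "\<bar>b\<bar>"] by (simp add: abs_mult)
  then show ?thesis by simp
qed

lemma integrable_mult_of_squares:
  fixes f g :: "'b \<Rightarrow> real"
  assumes "f \<in> borel_measurable L" "g \<in> borel_measurable L"
    and "integrable L (\<lambda>x. (f x)\<^sup>2)" "integrable L (\<lambda>x. (g x)\<^sup>2)"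
  shows "integrable L (\<lambda>x. f x * g x)"
proof (rule Bochner_Integration.integrable_bound)
  show "integrable L (\<lambda>x. (f x)\<^sup>2 + (g x)\<^sup>2)"
    using assms by simp
  show "(\<lambda>x. f x * g x) \<in> borel_measurable L"
    using assms by simp
  show "AE x in L. norm (f x * g x) \<le> norm ((f x)\<^sup>2 + (g x)\<^sup>2)"
    by (simp add: abs_mult_le_sum_squares)
qed

text \<open>Nonnegativity of the variance; on a probability space a square integrable
  \<open>f\<close> is integrable, so the usual variance formula applies.\<close>

lemma (in prob_space) square_integral_le:
  fixes f :: "'a \<Rightarrow> real"
  assumes "f \<in> borel_measurable M" "integrable M (\<lambda>x. (f x)\<^sup>2)"
  shows "(\<integral>x. f x \<partial>M)\<^sup>2 \<le> (\<integral>x. (f x)\<^sup>2 \<partial>M)"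
proof -
  have "integrable M f"
    using square_integrable_imp_integrable assms by blast
  then have "variance f = (\<integral>x. (f x)\<^sup>2 \<partial>M) - (\<integral>x. f x \<partial>M)\<^sup>2"
    using assms by (simp add: variance_eq)
  moreover have "0 \<le> variance f"
    by (rule variance_positive)
  ultimately show ?thesis by simp
qed

text \<open>By Jensen in \<open>w\<close>, the squared mixture is at most the mixture of the
  squares. The latter is integrable over \<open>y\<close> by Fubini, because the squared norms in
  \<open>y\<close> are bounded by the same \<open>C\<close> for all \<open>w\<close> and
  \<open>N\<close> has mass 1.\<close>

lemma mixture_square_integrable:
  fixes A :: "'b \<Rightarrow> 'a \<Rightarrow> real"
  assumes "prob_space N" "sigma_finite_measure L"
    and A [measurable]: "(\<lambda>(w, y). A y w) \<in> borel_measurable (N \<Otimes>\<^sub>M L)"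
    and A2: "\<And>w. w \<in> space N \<Longrightarrow> integrable L (\<lambda>y. (A y w)\<^sup>2)"
    and C: "\<And>w. w \<in> space N \<Longrightarrow> (\<integral>y. (A y w)\<^sup>2 \<partial>L) \<le> C"
  shows "(\<lambda>y. \<integral>w. A y w \<partial>N) \<in> borel_measurable L"
    and "integrable L (\<lambda>y. (\<integral>w. A y w \<partial>N)\<^sup>2)"
proof -
  interpret N: prob_space N by fact
  interpret L: sigma_finite_measure L by fact
  interpret NL: pair_sigma_finite N L ..
  have [measurable]: "(\<lambda>(y, w). A y w) \<in> borel_measurable (L \<Otimes>\<^sub>M N)"
    using A by (subst measurable_pair_swap_iff) (simp add: case_prod_beta)
  show meas [measurable]: "(\<lambda>y. \<integral>w. A y w \<partial>N) \<in> borel_measurable L"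
    by measurable
  have int: "integrable (N \<Otimes>\<^sub>M L) (\<lambda>(w, y). (A y w)\<^sup>2)"
  proof (rule NL.Fubini_integrable)
    show "(\<lambda>(w, y). (A y w)\<^sup>2) \<in> borel_measurable (N \<Otimes>\<^sub>M L)"
      by measurable
    show "AE w in N. integrable L (\<lambda>y. case (w, y) of (w, y) \<Rightarrow> (A y w)\<^sup>2)"
      using A2 by auto
    show "integrable N (\<lambda>w. \<integral>y. norm (case (w, y) of (w, y) \<Rightarrow> (A y w)\<^sup>2) \<partial>L)"
      using C by (intro N.integrable_const_bound[where B=C]) auto
  qed
  \<comment> \<open>Where the square is not integrable in \<open>w\<close>, its Bochner integral is
    0 by default and Jensen's bound may fail. The bound is therefore claimed only almost everywhere,
    which is enough for domination.\<close>
  have "AE y in L. integrable N (\<lambda>w. (A y w)\<^sup>2)"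
    using NL.AE_integrable_snd[OF int] by simp
  then have "AE y in L. (\<integral>w. A y w \<partial>N)\<^sup>2 \<le> (\<integral>w. (A y w)\<^sup>2 \<partial>N)"
  proof (rule AE_mp[OF _ AE_I2], intro impI)
    fix y assume "y \<in> space L" "integrable N (\<lambda>w. (A y w)\<^sup>2)"
    then show "(\<integral>w. A y w \<partial>N)\<^sup>2 \<le> (\<integral>w. (A y w)\<^sup>2 \<partial>N)"
      by (intro N.square_integral_le) auto
  qed
  then show "integrable L (\<lambda>y. (\<integral>w. A y w \<partial>N)\<^sup>2)"
    by (intro Bochner_Integration.integrable_bound[OF NL.integrable_snd[OF int]])
      (auto elim!: eventually_mono)
qed

text \<open>Fubini applied to \<open>A y w * v y\<close>. The mixed function is only controlled in
  L2, so \<open>A\<close> alone need not be integrable in \<open>y\<close>; pairing it with a square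
  integrable \<open>v\<close> gives absolute integrability on the product space.\<close>

lemma mixture_inner_product:
  fixes A :: "'b \<Rightarrow> 'a \<Rightarrow> real"
  assumes "prob_space N" "sigma_finite_measure L"
    and A [measurable]: "(\<lambda>(w, y). A y w) \<in> borel_measurable (N \<Otimes>\<^sub>M L)"
    and A2: "\<And>w. w \<in> space N \<Longrightarrow> integrable L (\<lambda>y. (A y w)\<^sup>2)"
    and C: "\<And>w. w \<in> space N \<Longrightarrow> (\<integral>y. (A y w)\<^sup>2 \<partial>L) \<le> C"
    and v [measurable]: "v \<in> borel_measurable L" and v2: "integrable L (\<lambda>y. (v y)\<^sup>2)"
  shows "(\<integral>y. (\<integral>w. A y w \<partial>N) * v y \<partial>L) = (\<integral>w. (\<integral>y. A y w * v y \<partial>L) \<partial>N)"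
proof -
  interpret N: prob_space N by fact
  interpret L: sigma_finite_measure L by fact
  interpret NL: pair_sigma_finite N L ..
  have Av: "integrable L (\<lambda>y. A y w * v y)" if "w \<in> space N" for w
    using that A2 v2 by (intro integrable_mult_of_squares) auto
  have "integrable (N \<Otimes>\<^sub>M L) (\<lambda>(w, y). A y w * v y)"
  proof (rule NL.Fubini_integrable)
    show "(\<lambda>(w, y). A y w * v y) \<in> borel_measurable (N \<Otimes>\<^sub>M L)"
      by measurable
    show "AE w in N. integrable L (\<lambda>y. case (w, y) of (w, y) \<Rightarrow> A y w * v y)"
      using Av by auto
    \<comment> \<open>The crude bound by the sum of the squares replaces Cauchy-Schwarz: all that
      matters is that it does not depend on \<open>w\<close>.\<close>
    have "\<bar>\<integral>y. \<bar>A y w * v y\<bar> \<partial>L\<bar> \<le> C + (\<integral>y. (v y)\<^sup>2 \<partial>L)" if w: "w \<in> space N" for w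
    proof -
      have "(\<integral>y. \<bar>A y w * v y\<bar> \<partial>L) \<le> (\<integral>y. (A y w)\<^sup>2 + (v y)\<^sup>2 \<partial>L)"
        using Av[OF w] A2[OF w] v2 abs_mult_le_sum_squares by (intro integral_mono) auto
      also have "\<dots> \<le> C + (\<integral>y. (v y)\<^sup>2 \<partial>L)"
        using A2[OF w] v2 C[OF w] by simp
      finally show ?thesis by simp
    qed
    then show "integrable N (\<lambda>w. \<integral>y. norm (case (w, y) of (w, y) \<Rightarrow> A y w * v y) \<partial>L)"
      by (intro N.integrable_const_bound[where B="C + (\<integral>y. (v y)\<^sup>2 \<partial>L)"]) auto
  qed
  from NL.Fubini_integral[OF this] show ?thesis by simp
qed

lemma borel_measurable_vec_nth [measurable]: "(\<lambda>y :: real ^ 'n. y $ k) \<in> borel_measurable borel"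
  by (intro borel_measurable_continuous_onI continuous_intros)

text \<open>Lebesgue measure on \<open>real ^ 'n\<close> is the image of a product of
  one-dimensional Lebesgue measures under the map from coordinates to vectors
  (\<open>lborel_eq\<close>), so the product formulas for \<open>Pi\<^sub>M\<close> carry
  over.\<close>

lemma
  fixes f :: "'n::finite \<Rightarrow> real \<Rightarrow> real"
  assumes f: "\<And>k. integrable lborel (f k)"
  shows integrable_lborel_prod_vec: "integrable lborel (\<lambda>y :: real ^ 'n. \<Prod>k\<in>UNIV. f k (y $ k))"
    and integral_lborel_prod_vec:
      "(\<integral>y. (\<Prod>k\<in>UNIV. f k ((y :: real ^ 'n) $ k)) \<partial>lborel) = (\<Prod>k\<in>UNIV. \<integral>x. f k x \<partial>lborel)"
proof -
  \<comment> \<open>The factors are indexed by the basis vectors, not by \<open>'n\<close>; the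
    bijection \<open>e\<close> below, and \<open>inv e\<close> in \<open>?G\<close>, translate
    between the two index sets.\<close>
  interpret product_sigma_finite "\<lambda>_ :: real ^ 'n. lborel :: real measure" ..
  have [measurable]: "f k \<in> borel_measurable borel" for k
    using borel_measurable_integrable[OF f[of k]] by simp
  define e :: "'n \<Rightarrow> real ^ 'n" where "e k = axis k 1" for k
  have inj: "inj e"
    by (auto simp: e_def inj_def axis_eq_axis)
  have B: "(Basis :: (real ^ 'n) set) = range e"
    by (auto simp: Basis_vec_def e_def)
  let ?\<phi> = "\<lambda>x. \<Sum>b\<in>(Basis :: (real ^ 'n) set). x b *\<^sub>R b"
  let ?F = "\<lambda>y :: real ^ 'n. \<Prod>k\<in>UNIV. f k (y $ k)"
  let ?G = "\<lambda>x. \<Prod>b\<in>(Basis :: (real ^ 'n) set). f (inv e b) (x b)"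
  let ?P = "Pi\<^sub>M (Basis :: (real ^ 'n) set) (\<lambda>_. lborel :: real measure)"
  have eq: "?F (?\<phi> x) = ?G x" for x
  proof -
    have "?\<phi> x $ k = x (e k)" for k
    proof -
      have "?\<phi> x $ k = ?\<phi> x \<bullet> e k" by (simp add: e_def inner_axis)
      also have "\<dots> = x (e k)" by (rule inner_sum_left_Basis) (simp add: B)
      finally show ?thesis .
    qed
    then show ?thesis
      by (simp add: B prod.reindex[OF inj] inv_f_f[OF inj])
  qed
  have \<phi>: "?\<phi> \<in> measurable ?P borel"
    by measurable
  have F: "?F \<in> borel_measurable borel"
    by measurable
  have "integrable ?P ?G"
    using f by (intro product_integrable_prod) auto
  then show "integrable lborel ?F"
    by (subst lborel_eq, subst integrable_distr_eq[OF \<phi> F]) (simp only: eq)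
  have "(\<integral>y. ?F y \<partial>lborel) = (\<integral>x. ?G x \<partial>?P)"
    by (subst lborel_eq, subst integral_distr[OF \<phi> F]) (simp only: eq)
  also have "\<dots> = (\<Prod>b\<in>Basis. \<integral>x. f (inv e b) x \<partial>lborel)"
    using f by (intro product_integral_prod) auto
  also have "\<dots> = (\<Prod>k\<in>UNIV. \<integral>x. f k x \<partial>lborel)"
    by (simp add: B prod.reindex[OF inj] inv_f_f[OF inj])
  finally show "(\<integral>y. ?F y \<partial>lborel) = (\<Prod>k\<in>UNIV. \<integral>x. f k x \<partial>lborel)" .
qed

lemma lborel_integrable_shift_iff:
  fixes f :: "real \<Rightarrow> real"
  shows "integrable lborel (\<lambda>x. f (x - a)) \<longleftrightarrow> integrable lborel f"
  using lborel_integrable_real_affine_iff[of 1 f "- a"] by simp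

lemma lborel_integral_shift:
  fixes f :: "real \<Rightarrow> real"
  shows "(\<integral>x. f (x - a) \<partial>lborel) = (\<integral>x. f x \<partial>lborel)"
  using lborel_integral_real_affine[of 1 f "- a"] by simp

text \<open>Substitute \<open>y = v + a\<close>. Translation invariance of the Bochner integral
  needs no integrability, so \<open>g\<close> is arbitrary.\<close>

lemma integral_shift_mult_shift:
  "(\<integral>y. g (y - a) * g (y - b) \<partial>lborel) = mirror_convolution g (a - b)"
  unfolding mirror_convolution_def
  using lborel_integral_shift[of "\<lambda>y. g (y + (a - b)) * g y" a]
  by (simp add: mult.commute add.commute)

text \<open>The substitution \<open>v = h * v'\<close> contributes a factor \<open>h\<close>, which
  cancels one of the two factors \<open>1 / h\<close> coming from the two kernels.\<close>

lemma mirror_convolution_scaled_kernel: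
  assumes "h > 0"
  shows "mirror_convolution (scaled_kernel \<kappa> h) = scaled_kernel (mirror_convolution \<kappa>) h"
proof
  fix u
  have "mirror_convolution (scaled_kernel \<kappa> h) u
      = h * (\<integral>v. \<kappa> (u / h + v) * \<kappa> v / (h * h) \<partial>lborel)"
    unfolding mirror_convolution_def scaled_kernel_def
    using lborel_integral_real_affine[of h "\<lambda>v. \<kappa> ((u + v) / h) / h * (\<kappa> (v / h) / h)" 0] assms
    by (simp add: add_divide_distrib)
  then show "mirror_convolution (scaled_kernel \<kappa> h) u = scaled_kernel (mirror_convolution \<kappa>) h u"
    using assms by (simp add: mirror_convolution_def scaled_kernel_def)
qed

text \<open>The claim for a general square integrable \<open>g\<close> and already normalised
  variables. The variables \<open>w\<close> and \<open>w'\<close> range separately over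
  \<open>M\<close>, so the second one acts as an independent copy of the sample; the coordinates
  \<open>Z k\<close> may depend on each other.\<close>

lemma integral_dependence_square:
  fixes g :: "real \<Rightarrow> real" and Z :: "'n::finite \<Rightarrow> 'a \<Rightarrow> real"
  assumes "prob_space M"
    and g [measurable]: "g \<in> borel_measurable borel" and g2: "integrable lborel (\<lambda>x. (g x)\<^sup>2)"
    and Z [measurable]: "\<And>k. Z k \<in> borel_measurable M"
  shows "(\<integral>y. ((\<integral>w. (\<Prod>k\<in>UNIV. g ((y :: real ^ 'n) $ k - Z k w)) \<partial>M)
        - (\<Prod>k\<in>UNIV. \<integral>w. g (y $ k - Z k w) \<partial>M))\<^sup>2 \<partial>lborel)
    = (\<integral>w. \<integral>w'. (\<Prod>k\<in>UNIV. mirror_convolution g (Z k w - Z k w')) \<partial>M \<partial>M)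
      + (\<Prod>k\<in>UNIV. \<integral>w. \<integral>w'. mirror_convolution g (Z k w - Z k w') \<partial>M \<partial>M)
      - 2 * (\<integral>w. (\<Prod>k\<in>UNIV. \<integral>w'. mirror_convolution g (Z k w - Z k w') \<partial>M) \<partial>M)"
proof -
  \<comment> \<open>All translates of \<open>g\<close> share this squared norm. It supplies the
    uniform bound \<open>C\<close> of the mixture lemmas: \<open>c\<close> in each coordinate and
    \<open>c ^ CARD('n)\<close> for the product.\<close>
  define c where "c = (\<integral>x. (g x)\<^sup>2 \<partial>lborel)"
  define a where "a k x w = g (x - Z k w)" for k x w
  define A where "A y w = (\<Prod>k\<in>UNIV. a k (y $ k) w)" for y :: "real ^ 'n" and w
  define u where "u k x = (\<integral>w. a k x w \<partial>M)" for k x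
  define U where "U y = (\<integral>w. A y w \<partial>M)" for y
  define V where "V y = (\<Prod>k\<in>UNIV. u k (y $ k))" for y :: "real ^ 'n"

  have sf: "sigma_finite_measure (lborel :: 'b::euclidean_space measure)" ..
  have a_meas: "(\<lambda>(w, x). a k x w) \<in> borel_measurable (M \<Otimes>\<^sub>M lborel)" for k
    unfolding a_def by measurable
  have a_meas1 [measurable]: "(\<lambda>x. a k x w) \<in> borel_measurable borel" for k w
    unfolding a_def by measurable
  have a2: "integrable lborel (\<lambda>x. (a k x w)\<^sup>2)" for k w
    unfolding a_def using g2 lborel_integrable_shift_iff[of "\<lambda>x. (g x)\<^sup>2"] by simp
  have ac: "(\<integral>x. (a k x w)\<^sup>2 \<partial>lborel) = c" for k w
    unfolding a_def c_def using lborel_integral_shift[of "\<lambda>x. (g x)\<^sup>2"] by simp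
  have aa: "(\<integral>x. a k x w * a k x w' \<partial>lborel) = mirror_convolution g (Z k w - Z k w')" for k w w'
    unfolding a_def by (rule integral_shift_mult_shift)
  have A_meas: "(\<lambda>(w, y). A y w) \<in> borel_measurable (M \<Otimes>\<^sub>M lborel)"
    unfolding A_def a_def by measurable
  have A_meas1 [measurable]: "(\<lambda>y. A y w) \<in> borel_measurable borel" for w
    unfolding A_def by measurable
  have A2: "integrable lborel (\<lambda>y. (A y w)\<^sup>2)" for w
    unfolding A_def prod_power_distrib by (rule integrable_lborel_prod_vec[OF a2])
  have Ac: "(\<integral>y. (A y w)\<^sup>2 \<partial>lborel) = c ^ CARD('n)" for w
    unfolding A_def prod_power_distrib by (subst integral_lborel_prod_vec[OF a2]) (simp add: ac)
  have AA: "(\<integral>y. A y w * A y w' \<partial>lborel)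
      = (\<Prod>k\<in>UNIV. mirror_convolution g (Z k w - Z k w'))" for w w'
    unfolding A_def prod.distrib[symmetric]
    by (subst integral_lborel_prod_vec)
      (simp_all add: aa integrable_mult_of_squares a2)

  note mix_u = mixture_square_integrable[OF \<open>prob_space M\<close> sf a_meas a2 eq_refl[OF ac], folded u_def]
  note inner_u = mixture_inner_product[OF \<open>prob_space M\<close> sf a_meas a2 eq_refl[OF ac], folded u_def]
  note mix_U = mixture_square_integrable[OF \<open>prob_space M\<close> sf A_meas A2 eq_refl[OF Ac], folded U_def]
  note inner_U = mixture_inner_product[OF \<open>prob_space M\<close> sf A_meas A2 eq_refl[OF Ac], folded U_def]
  note [measurable] = mix_u(1)[simplified] mix_U(1)[simplified]
  have V_meas [measurable]: "V \<in> borel_measurable borel"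
    unfolding V_def by measurable
  have V2: "integrable lborel (\<lambda>y. (V y)\<^sup>2)"
    unfolding V_def prod_power_distrib by (rule integrable_lborel_prod_vec[OF mix_u(2)])

  have ua: "(\<integral>x. u k x * a k x w \<partial>lborel) = (\<integral>w'. mirror_convolution g (Z k w - Z k w') \<partial>M)" for k w
    by (subst inner_u) (simp_all add: a2 aa[symmetric] mult.commute)
  \<comment> \<open>Here the test function is the mixture \<open>u k\<close> itself, admissible by
    \<open>mix_u(2)\<close>; the remaining inner integral is \<open>ua\<close>.\<close>
  have uu: "(\<integral>x. (u k x)\<^sup>2 \<partial>lborel) = (\<integral>w. \<integral>w'. mirror_convolution g (Z k w - Z k w') \<partial>M \<partial>M)" for k
    unfolding power2_eq_square
    by (subst inner_u) (simp_all add: mix_u(2) ua[symmetric] mult.commute)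
  have UA: "(\<integral>y. U y * A y w \<partial>lborel)
      = (\<integral>w'. (\<Prod>k\<in>UNIV. mirror_convolution g (Z k w - Z k w')) \<partial>M)" for w
    by (subst inner_U) (simp_all add: A2 AA[symmetric] mult.commute)
  have UU: "(\<integral>y. (U y)\<^sup>2 \<partial>lborel)
      = (\<integral>w. \<integral>w'. (\<Prod>k\<in>UNIV. mirror_convolution g (Z k w - Z k w')) \<partial>M \<partial>M)"
    unfolding power2_eq_square
    by (subst inner_U) (simp_all add: mix_U(2) UA[symmetric] mult.commute)
  have VV: "(\<integral>y. (V y)\<^sup>2 \<partial>lborel)
      = (\<Prod>k\<in>UNIV. \<integral>w. \<integral>w'. mirror_convolution g (Z k w - Z k w') \<partial>M \<partial>M)"
    unfolding V_def prod_power_distrib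
    by (subst integral_lborel_prod_vec[OF mix_u(2)]) (simp add: uu)
  have AV: "(\<integral>y. A y w * V y \<partial>lborel)
      = (\<Prod>k\<in>UNIV. \<integral>w'. mirror_convolution g (Z k w - Z k w') \<partial>M)" for w
    unfolding A_def V_def prod.distrib[symmetric]
    by (subst integral_lborel_prod_vec)
      (simp_all add: ua[symmetric] mult.commute integrable_mult_of_squares a2 mix_u(2))
  \<comment> \<open>\<open>U\<close> does not factor over the coordinates, but \<open>A\<close> does
    for fixed \<open>w\<close>. Hence the expectation is pulled out first and the factorisation
    \<open>AV\<close> is used under it.\<close>
  have UV: "(\<integral>y. U y * V y \<partial>lborel)
      = (\<integral>w. (\<Prod>k\<in>UNIV. \<integral>w'. mirror_convolution g (Z k w - Z k w') \<partial>M) \<partial>M)"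
    by (subst inner_U) (simp_all add: V2 AV)
  \<comment> \<open>Needed to split the integral of the expanded square into three terms.\<close>
  have UV_int: "integrable lborel (\<lambda>y. U y * V y)"
    by (rule integrable_mult_of_squares) (simp_all add: V2 mix_U(2))
  have "(\<integral>y. (U y - V y)\<^sup>2 \<partial>lborel) = (\<integral>y. (U y)\<^sup>2 + (V y)\<^sup>2 - 2 * (U y * V y) \<partial>lborel)"
    by (simp add: power2_diff mult.assoc)
  also have "\<dots> = (\<integral>y. (U y)\<^sup>2 \<partial>lborel) + (\<integral>y. (V y)\<^sup>2 \<partial>lborel) - 2 * (\<integral>y. U y * V y \<partial>lborel)"
    using V2 mix_U(2) UV_int by simp
  finally show ?thesis
    unfolding UU VV UV by (simp add: U_def V_def A_def a_def u_def)
qed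

theorem lemma2p4:
  fixes \<kappa> :: "real \<Rightarrow> real" and F :: "real \<Rightarrow> complex" and h :: real
    and \<sigma> :: "real measure \<Rightarrow> real"
    and M :: "'a measure" and Y :: "'n::finite \<Rightarrow> 'a \<Rightarrow> real"
  assumes "\<kappa> \<in> borel_measurable borel"
    and "integrable lborel (\<lambda>x. (\<kappa> x)\<^sup>2)"
    and "fourier_plancherel \<kappa> F"
    and "AE t in lborel. F t \<noteq> 0"
    and "h > 0"
    and "prob_space M"
    and "\<And>k. Y k \<in> borel_measurable M"
    and "\<And>k. integrable M (\<lambda>\<omega>. (Y k \<omega>)\<^sup>2)"
    and "\<And>k. scale_factor \<sigma> M (Y k)"
  shows "quadratic_dependence \<kappa> h \<sigma> M Y =
    1 / 2 * ((\<integral>\<omega>. joint_pi \<kappa> h \<sigma> M Y (\<chi> k. Y k \<omega>) \<partial>M)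
      + (\<Prod>k\<in>UNIV. \<integral>\<omega>. marginal_pi \<kappa> h \<sigma> M (Y k) (Y k \<omega>) \<partial>M)
      - 2 * (\<integral>\<omega>. (\<Prod>k\<in>UNIV. marginal_pi \<kappa> h \<sigma> M (Y k) (Y k \<omega>)) \<partial>M))"
proof -
  define g where "g = scaled_kernel \<kappa> h"
  \<comment> \<open>With this normalisation, the arguments of the kernels in \<open>joint_pi\<close>
    and \<open>marginal_pi\<close>, evaluated at the sample, become differences of two values of
    \<open>Z k\<close>.\<close>
  define Z where "Z k \<omega> = Y k \<omega> / scale_of \<sigma> M (Y k)" for k \<omega>
  note [measurable] = assms(1,7)
  have g_meas: "g \<in> borel_measurable borel"
    unfolding g_def scaled_kernel_def by measurable
  have "integrable lborel (\<lambda>x. (\<kappa> (x / h))\<^sup>2)"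
    using lborel_integrable_real_affine[OF assms(2), of "1 / h" 0] \<open>h > 0\<close> by simp
  then have g2: "integrable lborel (\<lambda>x. (g x)\<^sup>2)"
    by (simp add: g_def scaled_kernel_def power_divide)
  have Z_meas: "Z k \<in> borel_measurable M" for k
    unfolding Z_def by measurable
  have conv: "scaled_kernel (mirror_convolution \<kappa>) h = mirror_convolution g"
    unfolding g_def using mirror_convolution_scaled_kernel[OF \<open>h > 0\<close>] by simp
  show ?thesis
    using integral_dependence_square[where Z = Z, OF \<open>prob_space M\<close> g_meas g2 Z_meas]
    by (simp add: quadratic_dependence_def dependence_D_def joint_pi_def marginal_pi_def
        conv diff_divide_distrib flip: g_def Z_def)
qed

end
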